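(* There is an $O(N\,\mathrm{poly}(D))$-time reduction from a Restricted OAPT instance with two sets $A,B$ of $N$ tensors of size $D$ to a RegExp-String-Pair instance with a set of $N$ regular expressions of length $O(\mathrm{poly}(D))$ and a set of $N$ strings of length $D$ (the answer is preserved).
   Context: For even $t$, tensors $u,v\in\{0,1\}^{2\times\cdots\times2}$ ($t$ factors, size $D=2^t$) indexed by $i\in\{0,1\}^t$ have alternating product $p_{\mathrm{alt}}(u,v)=\bigwedge_{i_1}\bigvee_{i_2}\bigwedge_{i_3}\cdots\bigvee_{i_t}(u_i\wedge v_i)$. A tensor $x$ is $\wedge$-invariant if $x_i$ does not depend on $i_1,i_3,\dots,i_{t-1}$. Restricted OAPT: given two sets $A,B$ of $N$ such tensors, where one of the two sets contains only $\wedge$-invariant tensors, decide whether some $(a,b)\in A\times B$ has $p_{\mathrm{alt}}(a,b)=0$. Regular expressions are built from symbols by concatenation, alternation $[R\mid S]$, $[R]^+$, $[R]^*$, with language $L(\cdot)$. RegExp-String-Pair: given a set $A$ of regular expressions and a set $B$ of strings, decide whether some $b\in B$ lies in $L(a)$ for some $a\in A$. *)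

theory Defs
  imports Main "HOL-Library.FuncSet"
begin

text \<open>
  The bits 0 and 1 are \<^term>\<open>False\<close> and \<^term>\<open>True\<close>. The position \<^term>\<open>k\<close> of an index list is
  the index $i_{k+1}$, so the conjunctive indices $i_1, i_3, \ldots$ sit at even positions.
\<close>

type_synonym tensor = "bool list \<Rightarrow> bool"

definition tensors :: "nat \<Rightarrow> tensor set" where
  "tensors t = {i. length i = t} \<rightarrow>\<^sub>E UNIV"

fun alternate :: "bool \<Rightarrow> nat \<Rightarrow> tensor \<Rightarrow> bool" where
  "alternate c 0 w = w []"
| "alternate True (Suc n) w = (\<forall>b. alternate False n (\<lambda>i. w (b # i)))"
| "alternate False (Suc n) w = (\<exists>b. alternate True n (\<lambda>i. w (b # i)))"

definition p_alt :: "nat \<Rightarrow> tensor \<Rightarrow> tensor \<Rightarrow> bool" where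
  "p_alt t u v = alternate True t (\<lambda>i. u i \<and> v i)"

definition and_invariant :: "nat \<Rightarrow> tensor \<Rightarrow> bool" where
  "and_invariant t x \<longleftrightarrow>
     (\<forall>i j. length i = t \<and> length j = t \<and> (\<forall>k<t. odd k \<longrightarrow> i ! k = j ! k) \<longrightarrow> x i = x j)"

definition restricted_OAPT :: "nat \<Rightarrow> nat \<Rightarrow> tensor set \<Rightarrow> tensor set \<Rightarrow> bool" where
  "restricted_OAPT t N A B \<longleftrightarrow>
     even t \<and> A \<subseteq> tensors t \<and> B \<subseteq> tensors t \<and>
     finite A \<and> card A = N \<and> finite B \<and> card B = N \<and>
     ((\<forall>a\<in>A. and_invariant t a) \<or> (\<forall>b\<in>B. and_invariant t b))"

definition OAPT_answer :: "nat \<Rightarrow> tensor set \<Rightarrow> tensor set \<Rightarrow> bool" where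
  "OAPT_answer t A B \<longleftrightarrow> (\<exists>a\<in>A. \<exists>b\<in>B. \<not> p_alt t a b)"

text \<open>Symbols are characters: a fixed finite alphabet, independent of the instance.\<close>

datatype regexp =
    Symb char
  | Conc regexp regexp
  | Altn regexp regexp
  | Plus regexp
  | Star regexp

fun lang :: "regexp \<Rightarrow> string set" where
  "lang (Symb a) = {[a]}"
| "lang (Conc r s) = {u @ v | u v. u \<in> lang r \<and> v \<in> lang s}"
| "lang (Altn r s) = lang r \<union> lang s"
| "lang (Plus r) = {concat ws | ws. ws \<noteq> [] \<and> set ws \<subseteq> lang r}"
| "lang (Star r) = {concat ws | ws. set ws \<subseteq> lang r}"

definition RegExp_String_Pair_answer :: "regexp set \<Rightarrow> string set \<Rightarrow> bool" where
  "RegExp_String_Pair_answer R S \<longleftrightarrow> (\<exists>b\<in>S. \<exists>a\<in>R. b \<in> lang a)"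

text \<open>Metasymbols are kept apart from ordinary characters, so no escaping is needed.\<close>

datatype token = Chr char | LBrack | RBrack | Bar | PlusOp | StarOp | Comma | Semicolon

instance token :: finite
proof
  have "x \<in> range Chr \<union> {LBrack, RBrack, Bar, PlusOp, StarOp, Comma, Semicolon}" for x
    by (cases x) simp_all
  then have "(UNIV :: token set) \<subseteq>
    range Chr \<union> {LBrack, RBrack, Bar, PlusOp, StarOp, Comma, Semicolon}"
    by blast
  then show "finite (UNIV :: token set)"
    by (rule finite_subset) simp
qed

text \<open>
  The written form of a regular expression. Everything except concatenation is bracketed, so it
  determines the expression up to associativity of concatenation.
\<close>

fun write_regexp :: "regexp \<Rightarrow> token list" where
  "write_regexp (Symb a) = [Chr a]"
| "write_regexp (Conc r s) = write_regexp r @ write_regexp s"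
| "write_regexp (Altn r s) = [LBrack] @ write_regexp r @ [Bar] @ write_regexp s @ [RBrack]"
| "write_regexp (Plus r) = [LBrack] @ write_regexp r @ [RBrack, PlusOp]"
| "write_regexp (Star r) = [LBrack] @ write_regexp r @ [RBrack, StarOp]"

definition regexp_length :: "regexp \<Rightarrow> nat" where
  "regexp_length r = length (write_regexp r)"

definition write_string :: "string \<Rightarrow> token list" where
  "write_string s = map Chr s"

fun indices :: "nat \<Rightarrow> bool list list" where
  "indices 0 = [[]]"
| "indices (Suc t) = map (Cons False) (indices t) @ map (Cons True) (indices t)"

definition write_tensor :: "nat \<Rightarrow> tensor \<Rightarrow> token list" where
  "write_tensor t u = map (\<lambda>i. Chr (if u i then CHR ''1'' else CHR ''0'')) (indices t)"

definition write_pair ::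
  "('a \<Rightarrow> token list) \<Rightarrow> ('b \<Rightarrow> token list) \<Rightarrow> 'a list \<Rightarrow> 'b list \<Rightarrow> token list" where
  "write_pair f g xs ys =
     concat (map (\<lambda>x. f x @ [Comma]) xs) @ [Semicolon] @ concat (map (\<lambda>y. g y @ [Comma]) ys)"

text \<open>
  Structured programs for a multi-stack machine over a finite alphabet. A multi-tape Turing
  machine simulates one step in a constant number of steps and conversely, a tape being a pair of
  stacks; so running times agree with those of multi-tape Turing machines up to constant factors.

  \<^item> The head of a list is the top of the stack.
  \<^item> \<open>Move i j\<close> pops the top of stack \<open>i\<close> and pushes it onto stack \<open>j\<close>; it has no effect if
    stack \<open>i\<close> is empty.
  \<^item> \<open>Branch i X P Q\<close> and \<open>Loop i X P\<close> test whether the top of stack \<open>i\<close> lies in \<open>X\<close>, where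
    \<^term>\<open>None\<close> stands for the empty stack.
\<close>

datatype 'a program =
    Skip
  | Push nat 'a
  | Pop nat
  | Move nat nat
  | Then "'a program" "'a program"
  | Branch nat "'a option set" "'a program" "'a program"
  | Loop nat "'a option set" "'a program"

type_synonym 'a stacks = "nat \<Rightarrow> 'a list"

definition top_of :: "'a list \<Rightarrow> 'a option" where
  "top_of xs = (case xs of [] \<Rightarrow> None | x # _ \<Rightarrow> Some x)"

definition move :: "nat \<Rightarrow> nat \<Rightarrow> 'a stacks \<Rightarrow> 'a stacks" where
  "move i j s =
     (case s i of [] \<Rightarrow> s | x # xs \<Rightarrow> (let s' = s(i := xs) in s'(j := x # s' j)))"

text \<open>\<open>exec P s n s'\<close>: started on stacks \<open>s\<close>, program \<open>P\<close> halts after \<open>n\<close> steps with stacks \<open>s'\<close>.\<close>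

inductive exec :: "'a::finite program \<Rightarrow> 'a stacks \<Rightarrow> nat \<Rightarrow> 'a stacks \<Rightarrow> bool" where
  Skip: "exec Skip s 1 s"
| Push: "exec (Push i a) s 1 (s(i := a # s i))"
| Pop: "exec (Pop i) s 1 (s(i := tl (s i)))"
| Move: "exec (Move i j) s 1 (move i j s)"
| Then: "\<lbrakk>exec P s m s'; exec Q s' n s''\<rbrakk> \<Longrightarrow> exec (Then P Q) s (m + n) s''"
| BranchTrue: "\<lbrakk>top_of (s i) \<in> X; exec P s n s'\<rbrakk> \<Longrightarrow> exec (Branch i X P Q) s (n + 1) s'"
| BranchFalse: "\<lbrakk>top_of (s i) \<notin> X; exec Q s n s'\<rbrakk> \<Longrightarrow> exec (Branch i X P Q) s (n + 1) s'"
| LoopFalse: "top_of (s i) \<notin> X \<Longrightarrow> exec (Loop i X P) s 1 s"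
| LoopTrue: "\<lbrakk>top_of (s i) \<in> X; exec P s m s'; exec (Loop i X P) s' n s''\<rbrakk>
    \<Longrightarrow> exec (Loop i X P) s (m + n + 1) s''"

inductive_cases exec_SkipE: "exec Skip s n s'"
inductive_cases exec_PushE: "exec (Push i a) s n s'"
inductive_cases exec_PopE: "exec (Pop i) s n s'"
inductive_cases exec_MoveE: "exec (Move i j) s n s'"
inductive_cases exec_ThenE: "exec (Then P Q) s n s'"

lemma exec_deterministic:
  "exec P s m s' \<Longrightarrow> exec P s n s'' \<Longrightarrow> n = m \<and> s'' = s'"
proof (induction arbitrary: n s'' rule: exec.induct)
  case Skip then show ?case by (auto elim: exec_SkipE)
next
  case Push then show ?case by (auto elim: exec_PushE)
next
  case Pop then show ?case by (auto elim: exec_PopE)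
next
  case Move then show ?case by (auto elim: exec_MoveE)
next
  case (Then P s m s' Q k s3)
  from Then.prems obtain a b u where 1: "exec P s a u" "exec Q u b s''" "n = a + b"
    by (rule exec_ThenE)
  from Then.IH(1)[OF 1(1)] have 2: "a = m" "u = s'" by simp_all
  from Then.IH(2)[OF 1(2)[unfolded 2]] 1(3) 2(1) show ?case by simp
next
  case (BranchTrue s i X P k s' Q)
  from BranchTrue.prems BranchTrue.hyps(1) obtain a where 1: "exec P s a s''" "n = a + 1"
    by (cases rule: exec.cases) simp_all
  from BranchTrue.IH[OF 1(1)] 1(2) show ?case by simp
next
  case (BranchFalse s i X Q k s' P)
  from BranchFalse.prems BranchFalse.hyps(1) obtain a where 1: "exec Q s a s''" "n = a + 1"
    by (cases rule: exec.cases) simp_all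
  from BranchFalse.IH[OF 1(1)] 1(2) show ?case by simp
next
  case (LoopFalse s i X P)
  from LoopFalse.prems LoopFalse.hyps(1) show ?case
    by (cases rule: exec.cases) simp_all
next
  case (LoopTrue s i X P m s' k s3)
  from LoopTrue.prems LoopTrue.hyps(1) obtain a b u where
    1: "exec P s a u" "exec (Loop i X P) u b s''" "n = a + b + 1"
    by (cases rule: exec.cases) simp_all
  from LoopTrue.IH(1)[OF 1(1)] have 2: "a = m" "u = s'" by simp_all
  from LoopTrue.IH(2)[OF 1(2)[unfolded 2]] 1(3) 2(1) show ?case by simp
qed

text \<open>Input on stack 0, all other stacks empty; output on stack 1, first symbol on top.\<close>

definition computes_in_time :: "'a::finite program \<Rightarrow> 'a list \<Rightarrow> 'a list \<Rightarrow> nat \<Rightarrow> bool" where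
  "computes_in_time P x y T \<longleftrightarrow> (\<exists>n s. exec P ((\<lambda>_. [])(0 := x)) n s \<and> s 1 = y \<and> n \<le> T)"

end

theory Submission imports Defs begin

text \<open>
  The strings are the tensors of \<open>B\<close> written out. The negation of $p_{alt}$ is a formula with
  disjunctions over $i_1, i_3, \ldots$ and conjunctions over $i_2, i_4, \ldots$ of the conditions
  $\neg(u_i \wedge v_i)$. Such a condition is the expression \<open>0\<close> if $u_i = 1$ and \<open>[0|1]\<close>
  otherwise. If every expression involved matches words of one fixed length only, a conjunction is a
  concatenation $R_0 R_1$, and a disjunction is $[R_0 \Sigma^m | \Sigma^m R_1]$, where $m$ is the
  number of symbols matched by $R_0$ and by $R_1$. Two levels are
  handled at once: four neighbouring expressions, each matching $m$ symbols, become
  $[R_{00} R_{01} \Sigma^{2m} | \Sigma^{2m} R_{10} R_{11}]$. The machine works bottom-up, repeatedly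
  replacing groups of four expressions until one is left.
\<close>

section \<open>The regular expressions\<close>

definition any_symbol :: regexp where
  "any_symbol = Altn (Symb CHR ''0'') (Symb CHR ''1'')"

definition bit_char :: "bool \<Rightarrow> char" where
  "bit_char b = (if b then CHR ''1'' else CHR ''0'')"

definition leaf :: "bool \<Rightarrow> regexp" where
  "leaf b = (if b then Symb CHR ''0'' else any_symbol)"

definition pad_left :: "nat \<Rightarrow> regexp \<Rightarrow> regexp" where
  "pad_left h = (Conc any_symbol ^^ h)"

definition pad_right :: "nat \<Rightarrow> regexp \<Rightarrow> regexp" where
  "pad_right h = ((\<lambda>r. Conc r any_symbol) ^^ h)"

definition combine :: "nat \<Rightarrow> regexp \<Rightarrow> regexp \<Rightarrow> regexp \<Rightarrow> regexp \<Rightarrow> regexp" where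
  "combine h r00 r01 r10 r11 =
     Altn (pad_right h (Conc r00 r01)) (pad_left h (Conc r10 r11))"

definition combine_last :: "nat \<Rightarrow> (bool list \<Rightarrow> regexp) \<Rightarrow> bool list \<Rightarrow> regexp" where
  "combine_last h F i = combine h (F (i @ [False, False])) (F (i @ [False, True]))
     (F (i @ [True, False])) (F (i @ [True, True]))"

text \<open>The last two indices are merged first, in the order in which the machine works.
  \<open>h\<close> is twice the word length of the current expressions, hence the factor 4 per
  level.\<close>

fun build :: "nat \<Rightarrow> nat \<Rightarrow> (bool list \<Rightarrow> regexp) \<Rightarrow> regexp" where
  "build 0 h F = F []"
| "build (Suc k) h F = build k (4 * h) (combine_last h F)"

section \<open>Languages of paddings and merged expressions\<close>

lemma lang_any_symbol: "lang any_symbol = {[bit_char b] | b. True}"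
  by (auto simp: any_symbol_def bit_char_def)

lemma lang_pad_left:
  "lang (pad_left h r) = {map bit_char u @ v | u v. length u = h \<and> v \<in> lang r}"
proof (induction h)
  case 0
  then show ?case by (simp add: pad_left_def)
next
  case (Suc h)
  have "lang (pad_left (Suc h) r) = {u @ v | u v. u \<in> lang any_symbol \<and> v \<in> lang (pad_left h r)}"
    by (simp add: pad_left_def)
  also have "\<dots> = {map bit_char u @ v | u v. length u = Suc h \<and> v \<in> lang r}"
    unfolding Suc.IH lang_any_symbol
    apply (auto simp: length_Suc_conv)
    subgoal for b u v by (rule exI[of _ "b # u"]) auto
    by (metis append_Cons append_Nil)
  finally show ?case .
qed

lemma lang_pad_right:
  "lang (pad_right h r) = {v @ map bit_char u | u v. length u = h \<and> v \<in> lang r}"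
proof (induction h)
  case 0
  then show ?case by (simp add: pad_right_def)
next
  case (Suc h)
  have "lang (pad_right (Suc h) r) = {u @ v | u v. u \<in> lang (pad_right h r) \<and> v \<in> lang any_symbol}"
    by (simp add: pad_right_def)
  also have "\<dots> = {v @ map bit_char u | u v. length u = Suc h \<and> v \<in> lang r}"
    unfolding Suc.IH lang_any_symbol
    apply (auto simp: length_Suc_conv_rev)
     apply (metis append_assoc length_append_singleton list.simps(8,9) map_append)
    by (metis append_assoc)
  finally show ?case .
qed

text \<open>Every word of each expression has length \<open>m\<close>, so the cuts in a product are
  forced. Padding by \<open>2 * m\<close> arbitrary symbols places the chosen half of the word and
  leaves the other half free.\<close>

lemma combine_mem_iff:
  assumes "lang r00 \<subseteq> {w. length w = m}" "lang r01 \<subseteq> {w. length w = m}"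
    "lang r10 \<subseteq> {w. length w = m}" "lang r11 \<subseteq> {w. length w = m}"
    and "length u00 = m" "length u01 = m" "length u10 = m" "length u11 = m"
  shows "map bit_char (u00 @ u01 @ u10 @ u11) \<in> lang (combine (2 * m) r00 r01 r10 r11) \<longleftrightarrow>
      map bit_char u00 \<in> lang r00 \<and> map bit_char u01 \<in> lang r01 \<or>
      map bit_char u10 \<in> lang r10 \<and> map bit_char u11 \<in> lang r11"
proof -
  have "map bit_char (u00 @ u01 @ u10 @ u11) \<in> lang (pad_right (2 * m) (Conc r00 r01)) \<longleftrightarrow>
      map bit_char u00 \<in> lang r00 \<and> map bit_char u01 \<in> lang r01" (is "?l \<longleftrightarrow> ?r")
  proof
    assume ?l
    then obtain u v w where *: "map bit_char (u00 @ u01 @ u10 @ u11) = (v @ w) @ map bit_char u"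
      "length u = 2 * m" "v \<in> lang r00" "w \<in> lang r01"
      by (auto simp: lang_pad_right)
    have "length v = m" "length w = m" using * assms by auto
    then show ?r using * assms by (simp add: append_eq_append_conv)
  next
    assume ?r
    then have "map bit_char u00 @ map bit_char u01 \<in> lang (Conc r00 r01)" by auto
    then show ?l unfolding lang_pad_right using assms
      by (intro CollectI exI[of _ "u10 @ u11"] exI[of _ "map bit_char u00 @ map bit_char u01"]) simp
  qed
  moreover
  have "map bit_char (u00 @ u01 @ u10 @ u11) \<in> lang (pad_left (2 * m) (Conc r10 r11)) \<longleftrightarrow>
      map bit_char u10 \<in> lang r10 \<and> map bit_char u11 \<in> lang r11" (is "?l \<longleftrightarrow> ?r")
  proof
    assume ?l
    then obtain u v w where *: "map bit_char (u00 @ u01) @ map bit_char (u10 @ u11) = map bit_char u @ v @ w"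
      "length u = 2 * m" "v \<in> lang r10" "w \<in> lang r11"
      by (auto simp: lang_pad_left)
    have "length v = m" "length w = m" using * assms by auto
    have "map bit_char (u10 @ u11) = v @ w"
      by (rule append_eq_append_conv[THEN iffD1, OF _ *(1), THEN conjunct2]) (use * assms in simp)
    then show ?r using * assms \<open>length v = m\<close> by (simp add: append_eq_append_conv)
  next
    assume ?r
    then have "map bit_char u10 @ map bit_char u11 \<in> lang (Conc r10 r11)" by auto
    then show ?l unfolding lang_pad_left using assms
      by (intro CollectI exI[of _ "u00 @ u01"] exI[of _ "map bit_char u10 @ map bit_char u11"]) simp
  qed
  ultimately show ?thesis by (simp add: combine_def)
qed

lemma combine_length:
  assumes "lang r00 \<subseteq> {w. length w = m}" "lang r01 \<subseteq> {w. length w = m}"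
    "lang r10 \<subseteq> {w. length w = m}" "lang r11 \<subseteq> {w. length w = m}"
  shows "lang (combine (2 * m) r00 r01 r10 r11) \<subseteq> {w. length w = 4 * m}"
proof -
  have "length w = m" if "w \<in> lang r00 \<union> lang r01 \<union> lang r10 \<union> lang r11" for w
    using assms that by auto
  then show ?thesis
    by (fastforce simp: combine_def lang_pad_left lang_pad_right)
qed

text \<open>\<open>alternate\<close> takes indices off the front, while \<open>build\<close> merges
  at the back. The induction strips two indices in front, applies the hypothesis to the rest and
  folds them back in.\<close>

lemma alternate_snoc_snoc:
  "alternate True (2 * Suc k) w = alternate True (2 * k) (\<lambda>i. \<forall>b. \<exists>c. w (i @ [b, c]))"
proof (induction k arbitrary: w)
  case 0
  show ?case by (simp add: numeral_2_eq_2)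
next
  case (Suc k)
  have "alternate True (2 * Suc (Suc k)) w =
      (\<forall>b. \<exists>c. alternate True (2 * Suc k) (\<lambda>i. w (b # c # i)))"
    by simp
  also have "\<dots> = alternate True (2 * Suc k) (\<lambda>i. \<forall>b. \<exists>c. w (i @ [b, c]))"
    by (subst Suc.IH) simp
  finally show ?case .
qed

text \<open>The enumeration is lexicographic, so the four extensions of an index by two bits are
  neighbours. Hence merging four consecutive items is the same as applying
  \<open>combine_last\<close>.\<close>

lemma indices_snoc_snoc:
  "indices (Suc (Suc t)) = concat (map (\<lambda>i. [i @ [False, False], i @ [False, True],
     i @ [True, False], i @ [True, True]]) (indices t))"
proof (induction t)
  case (Suc t)
  show ?case
    by (subst indices.simps(2), subst (1 2) Suc.IH) (simp add: map_concat o_def)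
qed simp

text \<open>\<open>W i\<close> is the block of the word that is matched against \<open>F i\<close>.
  Blocks and expressions are merged in parallel, both becoming four times as long, so the induction
  generalises over \<open>m\<close>, \<open>F\<close> and \<open>W\<close>.\<close>

lemma build_mem_iff:
  assumes "\<And>i. lang (F i) \<subseteq> {w. length w = m}" "\<And>i. length (W i) = m"
  shows "map bit_char (concat (map W (indices (2 * k)))) \<in> lang (build k (2 * m) F) \<longleftrightarrow>
    \<not> alternate True (2 * k) (\<lambda>i. map bit_char (W i) \<notin> lang (F i))"
  using assms
proof (induction k arbitrary: m F W)
  case (Suc k)
  define W' where "W' i = W (i @ [False, False]) @ W (i @ [False, True]) @
    W (i @ [True, False]) @ W (i @ [True, True])" for i
  have "concat (map W (concat (map (\<lambda>i. [i @ [False, False], i @ [False, True],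
     i @ [True, False], i @ [True, True]]) is))) = concat (map W' is)" for "is"
    by (induction "is") (simp_all add: W'_def)
  then have W: "concat (map W (indices (2 * Suc k))) = concat (map W' (indices (2 * k)))"
    by (simp del: indices.simps add: indices_snoc_snoc)
  have F: "lang (combine_last (2 * m) F i) \<subseteq> {w. length w = 4 * m}" for i
    unfolding combine_last_def by (rule combine_length) (rule Suc.prems)+
  \<comment> \<open>Alternation realises the choice of \<open>b\<close> and concatenation the
    conjunction over \<open>c\<close>; negated, this is the innermost quantifier pair of
    \<open>alternate\<close>.\<close>
  have mem: "map bit_char (W' i) \<in> lang (combine_last (2 * m) F i) \<longleftrightarrow>
      \<not> (\<forall>b. \<exists>c. map bit_char (W (i @ [b, c])) \<notin> lang (F (i @ [b, c])))" for i
    unfolding W'_def combine_last_def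
    by (subst combine_mem_iff) (use Suc.prems in \<open>auto simp: all_bool_eq ex_bool_eq\<close>)
  have "length (W' i) = 4 * m" for i
    by (simp add: W'_def Suc.prems(2))
  then show ?case
    unfolding W alternate_snoc_snoc using Suc.IH[of "combine_last (2 * m) F" "4 * m" W', OF F]
    by (simp add: mem)
qed simp

section \<open>Injectivity of the construction\<close>

lemma pad_left_inject: "pad_left h r = pad_left h s \<Longrightarrow> r = s"
  by (induction h) (simp_all add: pad_left_def)

lemma pad_right_inject: "pad_right h r = pad_right h s \<Longrightarrow> r = s"
  by (induction h) (simp_all add: pad_right_def)

text \<open>Serves the count of expressions: distinct tensors must not collapse to one. The syntax
  tree is taken apart level by level, and every leaf can be recovered.\<close>

lemma build_inject:
  "build k h F = build k h F' \<Longrightarrow> length i = 2 * k \<Longrightarrow> F i = F' i"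
proof (induction k arbitrary: h F F' i)
  case (Suc k)
  obtain j b c where i: "i = j @ [b, c]" "length j = 2 * k"
    using Suc.prems(2) by (auto simp: length_Suc_conv_rev)
  have "combine_last h F j = combine_last h F' j"
    using Suc.IH[of "4 * h" "combine_last h F" "combine_last h F'" j] Suc.prems i(2) by simp
  then have "F (j @ [b, c]) = F' (j @ [b, c])" for b c
    by (cases b; cases c) (auto simp: combine_last_def combine_def dest: pad_left_inject pad_right_inject)
  then show ?case by (simp add: i(1))
qed simp

section \<open>Written form\<close>

definition any_tokens :: "token list" where
  "any_tokens = [LBrack, Chr CHR ''0'', Bar, Chr CHR ''1'', RBrack]"

lemma write_any_symbol: "write_regexp any_symbol = any_tokens"
  by (simp add: any_symbol_def any_tokens_def)

lemma concat_replicate_snoc: "concat (replicate n xs) @ xs = xs @ concat (replicate n xs)"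
  by (induction n) simp_all

lemma write_pad_left: "write_regexp (pad_left h r) = concat (replicate h any_tokens) @ write_regexp r"
  by (induction h) (simp_all add: pad_left_def write_any_symbol)

lemma write_pad_right: "write_regexp (pad_right h r) = write_regexp r @ concat (replicate h any_tokens)"
  by (induction h) (simp_all add: pad_right_def write_any_symbol concat_replicate_snoc)

text \<open>Concatenation writes no token of its own, so items are joined by plain copying. The
  right-hand side is in the order in which \<open>group_step\<close> emits.\<close>

lemma write_combine: "write_regexp (combine h r00 r01 r10 r11) =
    [LBrack] @ write_regexp r00 @ write_regexp r01 @ concat (replicate h any_tokens) @ [Bar] @
    concat (replicate h any_tokens) @ write_regexp r10 @ write_regexp r11 @ [RBrack]"
  by (simp add: combine_def write_pad_left write_pad_right)

section \<open>Length bounds and lists of written expressions\<close>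

lemma length_concat_replicate: "length (concat (replicate h xs)) = h * length xs"
  by (induction h) simp_all

text \<open>Two paddings of \<open>h\<close> symbols at five tokens each cost \<open>10 * h\<close>;
  the bar and the outer brackets cost 3.\<close>

lemma combine_last_length:
  assumes "\<And>i. regexp_length (F i) \<le> M"
  shows "regexp_length (combine_last h F i) \<le> 4 * M + 10 * h + 3"
  using assms[of "i @ [False, False]"] assms[of "i @ [False, True]"]
    assms[of "i @ [True, False]"] assms[of "i @ [True, True]"]
  by (simp add: regexp_length_def combine_last_def write_combine length_concat_replicate any_tokens_def)

text \<open>The quadratic bound survives a merge with room to spare:
  \<open>4 * (5 * m ^ 2) + 20 * m + 3\<close> is at most \<open>43 * m ^ 2\<close>, while
  \<open>80 * m ^ 2\<close> is allowed.\<close>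

lemma combine_last_length_quadratic:
  assumes "\<And>i. regexp_length (F i) \<le> 5 * m ^ 2" "m > 0"
  shows "regexp_length (combine_last (2 * m) F i) \<le> 5 * (4 * m) ^ 2"
proof -
  have "m \<le> m ^ 2" "1 \<le> m ^ 2" using assms(2) by (simp_all add: power2_eq_square)
  then show ?thesis
    using combine_last_length[of F "5 * m ^ 2" "2 * m" i, OF assms(1)] by (simp add: power_mult_distrib)
qed

lemma build_length:
  assumes "\<And>i. regexp_length (F i) \<le> 5 * m ^ 2" "m > 0"
  shows "regexp_length (build k (2 * m) F) \<le> 5 * (4 ^ k * m) ^ 2"
  using assms
proof (induction k arbitrary: m F)
  case (Suc k)
  show ?case
    using Suc.IH[of "combine_last (2 * m) F" "4 * m"] combine_last_length_quadratic[OF Suc.prems] Suc.prems(2)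
    by (simp add: ac_simps)
qed simp

text \<open>This makes the comma a safe end marker, so \<open>take_item\<close> stops exactly at the
  end of an expression.\<close>

lemma Comma_notin_write_regexp: "Comma \<notin> set (write_regexp r)"
  by (induction r) simp_all

definition items :: "(bool list \<Rightarrow> regexp) \<Rightarrow> bool list list \<Rightarrow> token list" where
  "items F is = concat (map (\<lambda>i. write_regexp (F i) @ [Comma]) is)"

lemma items_simps [simp]:
  "items F [] = []"
  "items F (i # is) = write_regexp (F i) @ Comma # items F is"
  "items F (is @ js) = items F is @ items F js"
  by (simp_all add: items_def)

lemma length_items_le:
  assumes "\<And>i. regexp_length (F i) \<le> M"
  shows "length (items F is) \<le> length is * (M + 1)"
proof (induction "is")
  case (Cons i "is")
  then show ?case using assms[of i] by (simp add: regexp_length_def)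
qed simp

section \<open>Running programs\<close>

text \<open>An upper bound instead of the exact step count lets both branches of a test share one
  bound and lets costs be rounded up.\<close>

definition runs :: "'a::finite program \<Rightarrow> 'a stacks \<Rightarrow> nat \<Rightarrow> 'a stacks \<Rightarrow> bool" where
  "runs P s T s' \<longleftrightarrow> (\<exists>n\<le>T. exec P s n s')"

lemma runs_weaken: "runs P s T s' \<Longrightarrow> T \<le> T' \<Longrightarrow> s' = s'' \<Longrightarrow> runs P s T' s''"
  unfolding runs_def by (meson le_trans)

lemma runs_Skip: "runs Skip s 1 s"
  and runs_Push: "runs (Push i a) s 1 (s(i := a # s i))"
  and runs_Pop: "runs (Pop i) s 1 (s(i := tl (s i)))"
  and runs_Move: "runs (Move i j) s 1 (move i j s)"
  unfolding runs_def by (blast intro: exec.intros)+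

lemma runs_Then: "runs P s m s' \<Longrightarrow> runs Q s' n s'' \<Longrightarrow> runs (Then P Q) s (m + n) s''"
  unfolding runs_def by (meson add_mono exec.Then)

lemma runs_Branch:
  assumes "top_of (s i) \<in> X \<Longrightarrow> runs P s n s'" "top_of (s i) \<notin> X \<Longrightarrow> runs Q s n s'"
  shows "runs (Branch i X P Q) s (n + 1) s'"
  using assms unfolding runs_def
  by (cases "top_of (s i) \<in> X") (meson add_mono order_refl exec.BranchTrue exec.BranchFalse)+

lemma runs_Loop_stop: "top_of (s i) \<notin> X \<Longrightarrow> runs (Loop i X P) s 1 s"
  unfolding runs_def by (blast intro: exec.LoopFalse)

lemma runs_Loop_step:
  "top_of (s i) \<in> X \<Longrightarrow> runs P s m s' \<Longrightarrow> runs (Loop i X P) s' n s'' \<Longrightarrow>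
    runs (Loop i X P) s (m + n + 1) s''"
  unfolding runs_def by (meson add_mono order_refl exec.LoopTrue)

text \<open>The invariant \<open>\<sigma>\<close> is indexed by the processed and the remaining part
  of a list. Each element costs the body and one test; the final failing test costs one more
  step.\<close>

lemma runs_Loop_list:
  fixes \<sigma> :: "'b list \<Rightarrow> 'b list \<Rightarrow> 'a::finite stacks"
  assumes "\<And>ys x xs. zs = ys @ x # xs \<Longrightarrow> top_of (\<sigma> ys (x # xs) i) \<in> X"
    and "\<And>ys x xs. zs = ys @ x # xs \<Longrightarrow> runs P (\<sigma> ys (x # xs)) T (\<sigma> (ys @ [x]) xs)"
    and "top_of (\<sigma> zs [] i) \<notin> X"
  shows "runs (Loop i X P) (\<sigma> [] zs) (length zs * (T + 1) + 1) (\<sigma> zs [])"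
proof -
  have "runs (Loop i X P) (\<sigma> ys xs) (length xs * (T + 1) + 1) (\<sigma> zs [])" if "zs = ys @ xs" for ys xs
    using that
  proof (induction xs arbitrary: ys)
    case Nil
    then show ?case using runs_Loop_stop[of "\<sigma> zs []" i X P] assms(3) by simp
  next
    case (Cons x xs)
    show ?case
      by (rule runs_weaken[OF runs_Loop_step[OF assms(1,2)[OF Cons.prems] Cons.IH]])
        (use Cons.prems in simp_all)
  qed
  from this[of "[]" zs] show ?thesis by simp
qed

fun seq :: "'a program list \<Rightarrow> 'a program" where
  "seq [] = Skip"
| "seq (P # Ps) = Then P (seq Ps)"

lemma runs_seq_Nil: "runs (seq []) s 1 s"
  using runs_Skip by simp

lemma runs_seq_Cons:
  "runs P s m s' \<Longrightarrow> runs (seq Ps) s' n s'' \<Longrightarrow> runs (seq (P # Ps)) s (m + n) s''"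
  by (simp add: runs_Then)

definition emit :: "nat \<Rightarrow> 'a list \<Rightarrow> 'a program" where
  "emit i xs = seq (map (Push i) xs)"

lemma runs_emit: "runs (emit i xs) s (length xs + 1) (s(i := rev xs @ s i))"
proof (induction xs arbitrary: s)
  case Nil
  then show ?case using runs_Skip by (simp add: emit_def)
next
  case (Cons x xs)
  show ?case
    unfolding emit_def list.map seq.simps
    by (rule runs_weaken[OF runs_Then[OF runs_Push Cons.IH[unfolded emit_def]]]) (auto simp: fun_eq_iff)
qed

lemma top_of_simps [simp]: "top_of [] = None" "top_of (x # xs) = Some x"
  by (simp_all add: top_of_def)

lemma top_of_eq_None [simp]: "top_of xs = None \<longleftrightarrow> xs = []"
  by (cases xs) simp_all

definition shift :: "nat \<Rightarrow> nat \<Rightarrow> 'a option set \<Rightarrow> 'a program" where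
  "shift i j X = Loop i X (Move i j)"

lemma runs_shift:
  assumes "s i = xs @ ys" "\<And>x. x \<in> set xs \<Longrightarrow> Some x \<in> X" "top_of ys \<notin> X" "i \<noteq> j"
  shows "runs (shift i j X) s (2 * length xs + 1) (s(i := ys, j := rev xs @ s j))"
proof -
  let ?\<sigma> = "\<lambda>us vs. s(i := vs @ ys, j := rev us @ s j)"
  have "runs (Loop i X (Move i j)) (?\<sigma> [] xs) (length xs * (1 + 1) + 1) (?\<sigma> xs [])"
    by (rule runs_Loop_list, goal_cases)
      (use assms in \<open>auto intro!: runs_weaken[OF runs_Move] simp: move_def fun_eq_iff\<close>)
  moreover have "?\<sigma> [] xs = s"
    using assms(1) by auto
  ultimately show ?thesis
    unfolding shift_def by (metis mult.commute one_add_one append_Nil)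
qed

abbreviation pour :: "nat \<Rightarrow> nat \<Rightarrow> 'a program" where
  "pour i j \<equiv> shift i j (- {None})"

lemma runs_pour:
  "i \<noteq> j \<Longrightarrow> runs (pour i j) s (2 * length (s i) + 1) (s(i := [], j := rev (s i) @ s j))"
  by (rule runs_shift) simp_all

definition drain :: "nat \<Rightarrow> 'a program" where
  "drain i = Loop i (- {None}) (Pop i)"

lemma runs_drain: "runs (drain i) s (2 * length (s i) + 1) (s(i := []))"
proof -
  let ?\<sigma> = "\<lambda>us vs. s(i := vs)"
  have "runs (Loop i (- {None}) (Pop i)) (?\<sigma> [] (s i)) (length (s i) * (1 + 1) + 1) (?\<sigma> (s i) [])"
    by (rule runs_Loop_list) (auto intro!: runs_weaken[OF runs_Pop])
  then show ?thesis unfolding drain_def fun_upd_triv by (rule runs_weaken) simp_all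
qed

section \<open>The program\<close>

text \<open>
  Stack 0 is the input and then scratch space, 1 the output, 2 the reversed input. Stack 3 holds the
  current expressions, each followed by a comma. Stacks 4 and 5 share the padding length in unary.
  Stack 6 holds, in unary, one less than the number of expressions, so it is empty when one is left.
\<close>

definition st :: "'a list \<Rightarrow> 'a list \<Rightarrow> 'a list \<Rightarrow> 'a list \<Rightarrow> 'a list \<Rightarrow> 'a list \<Rightarrow> 'a list \<Rightarrow> 'a stacks"
  where "st x0 x1 x2 x3 x4 x5 x6 =
    (\<lambda>_. [])(0 := x0, 1 := x1, 2 := x2, 3 := x3, 4 := x4, 5 := x5, 6 := x6)"

lemma st_select [simp]:
  "st x0 x1 x2 x3 x4 x5 x6 0 = x0"
  "st x0 x1 x2 x3 x4 x5 x6 1 = x1"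
  "st x0 x1 x2 x3 x4 x5 x6 (Suc 0) = x1"
  "st x0 x1 x2 x3 x4 x5 x6 2 = x2"
  "st x0 x1 x2 x3 x4 x5 x6 3 = x3"
  "st x0 x1 x2 x3 x4 x5 x6 4 = x4"
  "st x0 x1 x2 x3 x4 x5 x6 5 = x5"
  "st x0 x1 x2 x3 x4 x5 x6 6 = x6"
  by (simp_all add: st_def)

lemma st_update [simp]:
  "(st x0 x1 x2 x3 x4 x5 x6)(0 := x) = st x x1 x2 x3 x4 x5 x6"
  "(st x0 x1 x2 x3 x4 x5 x6)(1 := x) = st x0 x x2 x3 x4 x5 x6"
  "(st x0 x1 x2 x3 x4 x5 x6)(Suc 0 := x) = st x0 x x2 x3 x4 x5 x6"
  "(st x0 x1 x2 x3 x4 x5 x6)(2 := x) = st x0 x1 x x3 x4 x5 x6"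
  "(st x0 x1 x2 x3 x4 x5 x6)(3 := x) = st x0 x1 x2 x x4 x5 x6"
  "(st x0 x1 x2 x3 x4 x5 x6)(4 := x) = st x0 x1 x2 x3 x x5 x6"
  "(st x0 x1 x2 x3 x4 x5 x6)(5 := x) = st x0 x1 x2 x3 x4 x x6"
  "(st x0 x1 x2 x3 x4 x5 x6)(6 := x) = st x0 x1 x2 x3 x4 x5 x"
  by (simp_all add: st_def fun_eq_iff)

section \<open>Merging four neighbouring expressions\<close>

definition take_item :: "token program" where
  "take_item = seq [shift 3 0 (- {Some Comma}), Pop 3]"

lemma runs_take_item:
  "runs take_item (st x0 x1 x2 (write_regexp r @ Comma # x3) x4 x5 x6)
    (2 * regexp_length r + 3) (st (rev (write_regexp r) @ x0) x1 x2 x3 x4 x5 x6)"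
proof -
  have "runs (shift 3 0 (- {Some Comma})) (st x0 x1 x2 (write_regexp r @ Comma # x3) x4 x5 x6)
    (2 * regexp_length r + 1) (st (rev (write_regexp r) @ x0) x1 x2 (Comma # x3) x4 x5 x6)"
    by (rule runs_weaken[OF runs_shift[where xs = "write_regexp r" and ys = "Comma # x3"]])
      (use Comma_notin_write_regexp[of r] in \<open>auto simp: regexp_length_def\<close>)
  from runs_seq_Cons[OF this runs_seq_Cons[OF runs_Pop runs_seq_Nil], of 3]
  show ?thesis unfolding take_item_def by (rule runs_weaken) simp_all
qed

text \<open>The unary counter is moved instead of consumed, so a second padding can be produced by
  moving it back.\<close>

definition pad_out :: "nat \<Rightarrow> nat \<Rightarrow> token program" where
  "pad_out i j = Loop i (- {None}) (seq [Move i j, emit 0 any_tokens])"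

lemma runs_pad_out:
  assumes "i \<noteq> j" "i \<noteq> 0" "j \<noteq> 0" "s i = replicate h Comma"
  shows "runs (pad_out i j) s (9 * h + 1)
    (s(i := [], j := replicate h Comma @ s j, 0 := rev (concat (replicate h any_tokens)) @ s 0))"
proof -
  let ?\<sigma> = "\<lambda>us vs. s(i := vs, j := rev us @ s j,
    0 := rev (concat (replicate (length us) any_tokens)) @ s 0)"
  have "runs (Loop i (- {None}) (seq [Move i j, emit 0 any_tokens]))
    (?\<sigma> [] (s i)) (length (s i) * (8 + 1) + 1) (?\<sigma> (s i) [])"
  proof (rule runs_Loop_list)
    fix us x vs
    assume "s i = us @ x # vs"
    \<comment> \<open>One step for the move, six for emitting five tokens and one for the closing
      \<open>Skip\<close>.\<close>
    show "runs (seq [Move i j, emit 0 any_tokens]) (?\<sigma> us (x # vs)) 8 (?\<sigma> (us @ [x]) vs)"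
      by (rule runs_weaken[OF runs_seq_Cons[OF runs_Move runs_seq_Cons[OF runs_emit runs_seq_Nil]]])
        (use assms in \<open>auto simp: any_tokens_def move_def fun_eq_iff replicate_append_same
           simp flip: concat_replicate_snoc\<close>)
  qed (use assms in auto)
  moreover have "?\<sigma> [] (s i) = s"
    by auto
  ultimately show ?thesis
    using assms by (simp add: pad_out_def mult.commute)
qed

text \<open>\<open>take_item\<close> drops the comma, which joins two expressions to a
  concatenation. The result lies reversed on stack 0; the last push counts the finished
  groups.\<close>

definition group_step :: "token program" where
  "group_step = seq [Push 0 LBrack, take_item, take_item, pad_out 4 5, Push 0 Bar, pad_out 5 4,
     take_item, take_item, emit 0 [RBrack, Comma], Push 6 Comma]"

lemma runs_group_step:
  assumes "\<And>i. regexp_length (F i) \<le> M"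
  shows "runs group_step
    (st x0 x1 x2 (items F [i @ [False, False], i @ [False, True], i @ [True, False], i @ [True, True]] @ x3)
      (replicate h Comma) [] x6)
    (8 * M + 18 * h + 21)
    (st (rev (items (combine_last h F) [i]) @ x0) x1 x2 x3 (replicate h Comma) [] (Comma # x6))"
proof -
  have pad1: "runs (pad_out 4 5) (st x0 x1 x2 x3 (replicate h Comma) [] x6) (9 * h + 1)
     (st (rev (concat (replicate h any_tokens)) @ x0) x1 x2 x3 [] (replicate h Comma) x6)" for x0 x1 x2 x3 x6
    by (rule runs_weaken[OF runs_pad_out]) simp_all
  have pad2: "runs (pad_out 5 4) (st x0 x1 x2 x3 [] (replicate h Comma) x6) (9 * h + 1)
     (st (rev (concat (replicate h any_tokens)) @ x0) x1 x2 x3 (replicate h Comma) [] x6)" for x0 x1 x2 x3 x6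
    by (rule runs_weaken[OF runs_pad_out]) simp_all
  have push: "runs (Push 0 y) (st x0 x1 x2 x3 x4 x5 x6) 1 (st (y # x0) x1 x2 x3 x4 x5 x6)"
    for y and x0 x1 x2 x3 x4 x5 x6 :: "token list"
    using runs_Push[of 0 y "st x0 x1 x2 x3 x4 x5 x6"] by simp
  have emit: "runs (emit 0 [RBrack, Comma]) (st x0 x1 x2 x3 x4 x5 x6) 3
     (st (Comma # RBrack # x0) x1 x2 x3 x4 x5 x6)" for x0 x1 x2 x3 x4 x5 x6
    by (rule runs_weaken[OF runs_emit]) simp_all
  show ?thesis
    unfolding group_step_def items_simps append_Cons append_Nil append_assoc
    by (rule runs_weaken, (rule runs_seq_Cons push pad1 pad2 runs_take_item emit runs_Push runs_seq_Nil)+)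
      (use assms[of "i @ [False, False]"] assms[of "i @ [False, True]"]
        assms[of "i @ [True, False]"] assms[of "i @ [True, True]"] in
        \<open>simp_all add: combine_last_def write_combine\<close>)
qed

section \<open>One round and all rounds\<close>

definition quadruple :: "token program" where
  "quadruple = seq [Loop 4 (- {None}) (seq [Pop 4, emit 5 (replicate 4 Comma)]), pour 5 4]"

lemma runs_quadruple:
  "runs quadruple (st x0 x1 x2 x3 (replicate h Comma) [] x6) (16 * h + 3)
    (st x0 x1 x2 x3 (replicate (4 * h) Comma) [] x6)"
proof -
  let ?\<sigma> = "\<lambda>(us :: token list) vs. st x0 x1 x2 x3 vs (replicate (4 * length us) Comma) x6"
  have "runs (Loop 4 (- {None}) (seq [Pop 4, emit 5 (replicate 4 Comma)]))
    (?\<sigma> [] (replicate h Comma)) (length (replicate h Comma) * (7 + 1) + 1) (?\<sigma> (replicate h Comma) [])"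
  proof (rule runs_Loop_list)
    fix us vs x
    show "runs (seq [Pop 4, emit 5 (replicate 4 Comma)]) (?\<sigma> us (x # vs)) 7 (?\<sigma> (us @ [x]) vs)"
      by (rule runs_weaken[OF runs_seq_Cons[OF runs_Pop runs_seq_Cons[OF runs_emit runs_seq_Nil]]])
        (simp_all add: replicate_add[symmetric])
  qed simp_all
  then have 1: "runs (Loop 4 (- {None}) (seq [Pop 4, emit 5 (replicate 4 Comma)]))
    (st x0 x1 x2 x3 (replicate h Comma) [] x6) (8 * h + 1) (st x0 x1 x2 x3 [] (replicate (4 * h) Comma) x6)"
    by (simp add: mult.commute)
  have 2: "runs (pour 5 4) (st x0 x1 x2 x3 [] (replicate (4 * h) Comma) x6) (8 * h + 1)
    (st x0 x1 x2 x3 (replicate (4 * h) Comma) [] x6)"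
    by (rule runs_weaken[OF runs_pour]) simp_all
  show ?thesis
    unfolding quadruple_def
    by (rule runs_weaken[OF runs_seq_Cons[OF 1 runs_seq_Cons[OF 2 runs_seq_Nil]]]) simp_all
qed

text \<open>The old count is discarded and the groups are counted afresh. Pouring restores the order
  of the new list, and the \<open>Pop\<close> turns the count into the number of groups minus one,
  so emptiness of stack 6 signals a single remaining expression.\<close>

definition round_step :: "token program" where
  "round_step = seq [drain 6, Loop 3 (- {None}) group_step, pour 0 3, Pop 6, quadruple]"

lemma length_indices [simp]: "length (indices n) = 2 ^ n"
  by (induction n) simp_all

lemma items_snoc_snoc: "items F (indices (2 * Suc k)) =
    concat (map (\<lambda>i. items F [i @ [False, False], i @ [False, True],
      i @ [True, False], i @ [True, True]]) (indices (2 * k)))"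
proof -
  have "items F (concat (map (\<lambda>i. [i @ [False, False], i @ [False, True],
      i @ [True, False], i @ [True, True]]) is)) = concat (map (\<lambda>i. items F [i @ [False, False],
      i @ [False, True], i @ [True, False], i @ [True, True]]) is)" for "is"
    by (induction "is") simp_all
  then show ?thesis by (simp del: indices.simps items_simps add: indices_snoc_snoc)
qed

lemma runs_round_step:
  assumes F: "\<And>i. regexp_length (F i) \<le> M"
  shows "runs round_step
    (st [] x1 x2 (items F (indices (2 * Suc k))) (replicate h Comma) [] x6)
    (4 ^ k * (16 * M + 38 * h + 30) + 16 * h + 2 * length x6 + 8)
    (st [] x1 x2 (items (combine_last h F) (indices (2 * k))) (replicate (4 * h) Comma) []
       (replicate (4 ^ k - 1) Comma))"
proof -
  let ?G = "combine_last h F" and ?is = "indices (2 * k)"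
  let ?quad = "\<lambda>i. items F [i @ [False, False], i @ [False, True], i @ [True, False], i @ [True, True]]"
  let ?\<sigma> = "\<lambda>us vs. st (rev (items ?G us)) x1 x2 (concat (map ?quad vs))
    (replicate h Comma) [] (replicate (length us) Comma)"
  have len: "length ?is = 4 ^ k"
    by (simp add: power_mult)
  have 1: "runs (drain 6) (st [] x1 x2 x3 (replicate h Comma) [] x6) (2 * length x6 + 1)
      (st [] x1 x2 x3 (replicate h Comma) [] [])" for x3
    using runs_drain[of 6 "st [] x1 x2 x3 (replicate h Comma) [] x6"] by simp
  have "runs (Loop 3 (- {None}) group_step) (?\<sigma> [] ?is)
      (length ?is * (8 * M + 18 * h + 21 + 1) + 1) (?\<sigma> ?is [])"
  proof (rule runs_Loop_list)
    fix us i vs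
    show "runs group_step (?\<sigma> us (i # vs)) (8 * M + 18 * h + 21) (?\<sigma> (us @ [i]) vs)"
      unfolding list.map concat.simps
      by (rule runs_weaken[OF runs_group_step[of F M, OF F]]) (simp_all add: replicate_append_same)
  qed simp_all
  then have 2: "runs (Loop 3 (- {None}) group_step)
      (st [] x1 x2 (items F (indices (2 * Suc k))) (replicate h Comma) [] [])
      (4 ^ k * (8 * M + 18 * h + 22) + 1)
      (st (rev (items ?G ?is)) x1 x2 [] (replicate h Comma) [] (replicate (4 ^ k) Comma))"
    unfolding items_snoc_snoc len by (simp add: add.commute del: items_simps(2,3) length_indices)
  \<comment> \<open>Pouring costs two steps per token, so the new list must be bounded; each item
    contributes one extra comma.\<close>
  have "length (items ?G ?is) \<le> 4 ^ k * (4 * M + 10 * h + 4)"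
    using length_items_le[of ?G "4 * M + 10 * h + 3" ?is] combine_last_length[of F M h, OF F] len
    by (simp add: add.commute)
  then have 3: "runs (pour 0 3)
      (st (rev (items ?G ?is)) x1 x2 [] (replicate h Comma) [] (replicate (4 ^ k) Comma))
      (4 ^ k * (8 * M + 20 * h + 8) + 1)
      (st [] x1 x2 (items ?G ?is) (replicate h Comma) [] (replicate (4 ^ k) Comma))"
    by (intro runs_weaken[OF runs_pour]) (simp_all add: algebra_simps)
  have 4: "runs (Pop 6) (st [] x1 x2 x3 x4 [] (replicate n Comma)) 1
      (st [] x1 x2 x3 x4 [] (replicate (n - 1) Comma))" for x3 x4 n
    by (rule runs_weaken[OF runs_Pop]) simp_all
  show ?thesis
    unfolding round_step_def
    by (rule runs_weaken[OF runs_seq_Cons[OF 1 runs_seq_Cons[OF 2 runs_seq_Cons[OF 3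
            runs_seq_Cons[OF 4 runs_seq_Cons[OF runs_quadruple runs_seq_Nil]]]]]])
      (simp_all add: algebra_simps)
qed

text \<open>A round divides the number of items by 4 and multiplies the word length by 4, so the
  total \<open>4 ^ k * m\<close> is preserved. Each round costs at most 19 times its square; the
  twentieth share pays for the loop test.\<close>

lemma runs_rounds:
  assumes "\<And>i. regexp_length (F i) \<le> 5 * m ^ 2" "m > 0"
  shows "runs (Loop 6 (- {None}) round_step)
    (st [] x1 x2 (items F (indices (2 * k))) (replicate (2 * m) Comma) [] (replicate (4 ^ k - 1) Comma))
    (20 * k * (4 ^ k * m) ^ 2 + 1)
    (st [] x1 x2 (write_regexp (build k (2 * m) F) @ [Comma]) (replicate (2 * (4 ^ k * m)) Comma) [] [])"
  using assms
proof (induction k arbitrary: m F)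
  case 0
  show ?case
    using runs_Loop_stop[of "st [] x1 x2 (write_regexp (F []) @ [Comma]) (replicate (2 * m) Comma) [] []"
        6 "- {None}" round_step]
    by simp
next
  case (Suc k)
  define n :: nat where "n = 4 ^ k"
  \<comment> \<open>\<open>q\<close> dominates every monomial in the cost of a round: the
    coefficients 80, 76, 38, 32 and 8 add up to 234, below \<open>19 * 16\<close>.\<close>
  define q where "q = n * m ^ 2"
  have "n \<ge> 1" by (simp add: n_def)
  have "n * 1 \<le> n * m ^ 2" "n * m \<le> n * m ^ 2" "1 * m \<le> n * m ^ 2"
    using Suc.prems(2) \<open>n \<ge> 1\<close> by (auto simp: power2_eq_square intro: mult_le_mono)
  then have q: "n \<le> q" "n * m \<le> q" "m \<le> q" "1 \<le> q"
    using \<open>n \<ge> 1\<close> by (simp_all add: q_def)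
  have "q \<le> n ^ 2 * m ^ 2"
    unfolding q_def using \<open>n \<ge> 1\<close> by (intro mult_le_mono) (simp_all add: power2_eq_square)
  then have sq: "16 * q \<le> (4 ^ Suc k * m) ^ 2"
    by (simp add: n_def[symmetric] power_mult_distrib)
  have "n * (16 * (5 * m ^ 2) + 38 * (2 * m) + 30) + 16 * (2 * m) + 2 * (4 * n - 1) + 8
      \<le> 80 * q + 76 * (n * m) + 38 * n + 32 * m + 8"
    by (simp add: q_def algebra_simps)
  also have "\<dots> \<le> 19 * (16 * q)"
    using q by linarith
  also have "\<dots> \<le> 19 * (4 ^ Suc k * m) ^ 2"
    using sq by (rule mult_le_mono2)
  finally have step: "runs round_step
    (st [] x1 x2 (items F (indices (2 * Suc k))) (replicate (2 * m) Comma) [] (replicate (4 ^ Suc k - 1) Comma))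
    (19 * (4 ^ Suc k * m) ^ 2)
    (st [] x1 x2 (items (combine_last (2 * m) F) (indices (2 * k))) (replicate (2 * (4 * m)) Comma) []
       (replicate (4 ^ k - 1) Comma))"
    by (intro runs_weaken[OF runs_round_step[OF Suc.prems(1)]]) (simp_all add: n_def)
  have IH: "runs (Loop 6 (- {None}) round_step)
    (st [] x1 x2 (items (combine_last (2 * m) F) (indices (2 * k))) (replicate (2 * (4 * m)) Comma) []
       (replicate (4 ^ k - 1) Comma))
    (20 * k * (4 ^ Suc k * m) ^ 2 + 1)
    (st [] x1 x2 (write_regexp (build (Suc k) (2 * m) F) @ [Comma])
       (replicate (2 * (4 ^ Suc k * m)) Comma) [] [])"
    using Suc.IH[of "combine_last (2 * m) F" "4 * m"] combine_last_length_quadratic[OF Suc.prems] Suc.prems(2)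
    by (simp add: ac_simps)
  \<comment> \<open>Hence stack 6 is not empty and the loop is entered.\<close>
  have "(4::nat) ^ Suc k > 1"
    by (rule one_less_power) simp_all
  then show ?case
    by (intro runs_weaken[OF runs_Loop_step[OF _ step IH]])
      (use sq q(4) in \<open>simp_all add: algebra_simps Suc_le_eq Suc.prems(2)\<close>)
qed

section \<open>Translating one tensor\<close>

definition load :: "token program" where
  "load = Loop 2 (- {None, Some Comma})
     (seq [Branch 2 {Some (Chr CHR ''1'')} (emit 3 [Comma, Chr CHR ''0'']) (emit 3 (Comma # rev any_tokens)),
       Pop 2, Push 6 Comma])"

lemma write_tensor_eq: "write_tensor t u = map (\<lambda>i. Chr (bit_char (u i))) (indices t)"
  by (simp add: write_tensor_def bit_char_def)

text \<open>Stack 2 holds the tensor backwards and pushing reverses once more, so the items appear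
  in index order. The end is recognised by the comma of the preceding tensor or by the empty
  stack.\<close>

lemma runs_load:
  assumes "top_of x2 \<in> {None, Some Comma}"
  shows "runs load (st x0 x1 (rev (write_tensor t u) @ x2) [] x4 x5 []) (12 * 2 ^ t + 1)
    (st x0 x1 x2 (items (\<lambda>i. leaf (u i)) (indices t)) x4 x5 (replicate (2 ^ t) Comma))"
proof -
  let ?\<sigma> = "\<lambda>us vs. st x0 x1 (map (\<lambda>i. Chr (bit_char (u i))) vs @ x2)
     (items (\<lambda>i. leaf (u i)) (rev us)) x4 x5 (replicate (length us) Comma)"
  have "runs load (?\<sigma> [] (rev (indices t))) (length (rev (indices t)) * (11 + 1) + 1)
     (?\<sigma> (rev (indices t)) [])"
    unfolding load_def
  proof (rule runs_Loop_list)
    fix us i vs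
    let ?s = "?\<sigma> us (i # vs)"
    have "runs (Branch 2 {Some (Chr CHR ''1'')} (emit 3 [Comma, Chr CHR ''0'']) (emit 3 (Comma # rev any_tokens)))
      ?s (7 + 1) (?s(3 := items (\<lambda>i. leaf (u i)) (rev (us @ [i]))))"
      by (rule runs_Branch; rule runs_weaken[OF runs_emit])
        (simp_all add: leaf_def bit_char_def write_any_symbol any_tokens_def split: if_splits)
    from runs_seq_Cons[OF this runs_seq_Cons[OF runs_Pop runs_seq_Cons[OF runs_Push runs_seq_Nil]], of 2 6 Comma]
    show "runs (seq [Branch 2 {Some (Chr CHR ''1'')} (emit 3 [Comma, Chr CHR ''0''])
        (emit 3 (Comma # rev any_tokens)), Pop 2, Push 6 Comma]) ?s 11 (?\<sigma> (us @ [i]) vs)"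
      by (rule runs_weaken) simp_all
  qed (use assms in auto)
  then show ?thesis
    by (simp add: write_tensor_eq rev_map mult.commute)
qed

text \<open>Leaves match one symbol, so the first padding has length 2; each level of
  \<open>build\<close> consumes two of the \<open>t\<close> indices.\<close>

definition tensor_regexp :: "nat \<Rightarrow> tensor \<Rightarrow> regexp" where
  "tensor_regexp t u = build (t div 2) 2 (\<lambda>i. leaf (u i))"

text \<open>Stack 4 may still hold the padding length of the previous tensor and is reset to 2. The
  two final pours reverse twice, which puts the expression in front of the output in reading
  order.\<close>

definition tensor_step :: "token program" where
  "tensor_step = seq [Pop 2, drain 4, emit 4 [Comma, Comma], load, Pop 6,
     Loop 6 (- {None}) round_step, pour 3 0, pour 0 1]"

lemma regexp_length_leaf: "regexp_length (leaf b) \<le> 5"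
  by (simp add: leaf_def regexp_length_def write_any_symbol any_tokens_def)

lemma four_power_half: "even t \<Longrightarrow> (4::nat) ^ (t div 2) = 2 ^ t"
  by (auto elim!: evenE simp: power_mult)

lemma tensor_regexp_length: "even t \<Longrightarrow> regexp_length (tensor_regexp t u) \<le> 5 * (2 ^ t) ^ 2"
  using build_length[of "\<lambda>i. leaf (u i)" 1 "t div 2"] regexp_length_leaf
  by (simp add: tensor_regexp_def four_power_half)

lemma runs_tensor_step:
  assumes t: "even t" and x2: "top_of x2 \<in> {None, Some Comma}" and x4: "length x4 \<le> 2 * 2 ^ t"
  shows "runs tensor_step (st [] x1 (Comma # rev (write_tensor t u) @ x2) [] x4 [] [])
    (80 * (2 ^ t) ^ 3)
    (st [] (write_regexp (tensor_regexp t u) @ [Comma] @ x1) x2 [] (replicate (2 * 2 ^ t) Comma) [] [])"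
proof -
  define k where "k = t div 2"
  define D :: nat where "D = 2 ^ t"
  have k: "2 * k = t" "4 ^ k = D" "D \<ge> 1"
    using t by (simp_all add: k_def D_def four_power_half)
  let ?r = "tensor_regexp t u" and ?F = "\<lambda>i. leaf (u i)"
  let ?w = "rev (write_tensor t u)"
  have pop2: "runs (Pop 2) (st [] x1 (Comma # ?w @ x2) [] x4 [] []) 1 (st [] x1 (?w @ x2) [] x4 [] [])"
    by (rule runs_weaken[OF runs_Pop]) simp_all
  have drain4: "runs (drain 4) (st [] x1 (?w @ x2) [] x4 [] []) (4 * D + 1) (st [] x1 (?w @ x2) [] [] [] [])"
    by (rule runs_weaken[OF runs_drain]) (use x4 in \<open>simp_all add: D_def\<close>)
  have emit4: "runs (emit 4 [Comma, Comma]) (st [] x1 (?w @ x2) [] [] [] []) 3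
      (st [] x1 (?w @ x2) [] (replicate 2 Comma) [] [])"
    by (rule runs_weaken[OF runs_emit]) (simp_all add: numeral_2_eq_2)
  have load: "runs load (st [] x1 (?w @ x2) [] (replicate 2 Comma) [] []) (12 * D + 1)
      (st [] x1 x2 (items ?F (indices (2 * k))) (replicate 2 Comma) [] (replicate D Comma))"
    using runs_load[OF x2] by (simp add: k(1) D_def)
  have pop6: "runs (Pop 6) (st [] x1 x2 (items ?F (indices (2 * k))) (replicate 2 Comma) [] (replicate D Comma)) 1
      (st [] x1 x2 (items ?F (indices (2 * k))) (replicate 2 Comma) [] (replicate (D - 1) Comma))"
    by (rule runs_weaken[OF runs_Pop]) simp_all
  have loop: "runs (Loop 6 (- {None}) round_step)
      (st [] x1 x2 (items ?F (indices (2 * k))) (replicate 2 Comma) [] (replicate (D - 1) Comma))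
      (20 * k * D ^ 2 + 1)
      (st [] x1 x2 (write_regexp ?r @ [Comma]) (replicate (2 * D) Comma) [] [])"
    using runs_rounds[of ?F 1 x1 x2 k] regexp_length_leaf by (simp add: k tensor_regexp_def k_def[symmetric])
  have len: "length (write_regexp ?r) \<le> 5 * D ^ 2"
    using tensor_regexp_length[OF t, of u] by (simp add: regexp_length_def D_def)
  have pour30: "runs (pour 3 0) (st [] x1 x2 (write_regexp ?r @ [Comma]) (replicate (2 * D) Comma) [] [])
      (10 * D ^ 2 + 3) (st (Comma # rev (write_regexp ?r)) x1 x2 [] (replicate (2 * D) Comma) [] [])"
    by (rule runs_weaken[OF runs_pour]) (use len in simp_all)
  have pour01: "runs (pour 0 1) (st (Comma # rev (write_regexp ?r)) x1 x2 [] (replicate (2 * D) Comma) [] [])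
      (10 * D ^ 2 + 3)
      (st [] (write_regexp ?r @ [Comma] @ x1) x2 [] (replicate (2 * D) Comma) [] [])"
    by (rule runs_weaken[OF runs_pour]) (use len in simp_all)
  \<comment> \<open>The number of rounds is below \<open>D\<close>, so the quadratic cost per round
    adds up to a cubic bound.\<close>
  have "k < 4 ^ k" by (rule less_exp[THEN less_le_trans]) (simp add: power_mono)
  then have "k * D ^ 2 \<le> D ^ 3"
    by (simp add: k power2_eq_square power3_eq_cube)
  moreover have "D \<le> D ^ 3" "D ^ 2 \<le> D ^ 3" "1 \<le> D ^ 3"
    using k(3) by (simp_all add: power_increasing self_le_power)
  ultimately have "20 * k * D ^ 2 + 20 * D ^ 2 + 16 * D + 20 \<le> 80 * D ^ 3"
    by linarith
  then show ?thesis
    unfolding tensor_step_def D_def[symmetric]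
    by (intro runs_weaken[OF runs_seq_Cons[OF pop2 runs_seq_Cons[OF drain4 runs_seq_Cons[OF emit4
          runs_seq_Cons[OF load runs_seq_Cons[OF pop6 runs_seq_Cons[OF loop
          runs_seq_Cons[OF pour30 runs_seq_Cons[OF pour01 runs_seq_Nil]]]]]]]]]) simp_all
qed

section \<open>The whole reduction and its running time\<close>

definition reduction :: "token program" where
  "reduction = seq [pour 0 2, shift 2 1 (- {Some Semicolon}), Move 2 1, Loop 2 (- {None}) tensor_step]"

definition tensor_string :: "nat \<Rightarrow> tensor \<Rightarrow> string" where
  "tensor_string t u = map (\<lambda>i. bit_char (u i)) (indices t)"

text \<open>The strings are written exactly like the tensors, so the second half of the input is
  copied unchanged.\<close>

lemma write_tensor_string: "write_string (tensor_string t u) = write_tensor t u"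
  by (simp add: write_string_def tensor_string_def write_tensor_eq)

text \<open>Reversing the input gives access to \<open>B\<close> first; it is moved to the output in
  its original order. The tensors of \<open>A\<close> then come last to first, and each expression
  is put in front, so their order is kept too.\<close>

lemma runs_reduction:
  assumes t: "even t" and len: "length A = N" "length B = N"
  shows "runs reduction ((\<lambda>_. [])(0 := write_pair (write_tensor t) (write_tensor t) A B))
    (100 * max 1 N * (2 ^ t) ^ 3)
    (st [] (write_pair write_regexp write_string (map (tensor_regexp t) A) (map (tensor_string t) B))
       [] [] (replicate (if A = [] then 0 else 2 * 2 ^ t) Comma) [] [])"
proof -
  define D :: nat where "D = 2 ^ t"
  define as bs where "as = concat (map (\<lambda>u. write_tensor t u @ [Comma]) A)"
    and "bs = concat (map (\<lambda>u. write_tensor t u @ [Comma]) B)"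
  have len_as: "length as = N * (D + 1)" and len_bs: "length bs = N * (D + 1)"
    unfolding as_def bs_def using len
    by (simp_all add: length_concat o_def write_tensor_def D_def sum_list_triv)
  have input: "(\<lambda>_. [])(0 := write_pair (write_tensor t) (write_tensor t) A B) =
      st (as @ [Semicolon] @ bs) [] [] [] [] [] []"
    by (simp add: st_def write_pair_def as_def bs_def fun_eq_iff)
  have 1: "runs (pour 0 2) (st (as @ [Semicolon] @ bs) [] [] [] [] [] []) (4 * (N * (D + 1)) + 3)
      (st [] [] (rev bs @ Semicolon # rev as) [] [] [] [])"
    by (rule runs_weaken[OF runs_pour]) (simp_all add: len_as len_bs)
  have "Semicolon \<notin> set bs"
    by (auto simp: bs_def write_tensor_def)
  then have 2: "runs (shift 2 1 (- {Some Semicolon})) (st [] [] (rev bs @ Semicolon # rev as) [] [] [] [])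
      (2 * (N * (D + 1)) + 1) (st [] bs (Semicolon # rev as) [] [] [] [])"
    by (intro runs_weaken[OF runs_shift[of _ 2 "rev bs" "Semicolon # rev as"]]) (auto simp: len_bs)
  have 3: "runs (Move 2 1) (st [] bs (Semicolon # rev as) [] [] [] []) 1
      (st [] (Semicolon # bs) (rev as) [] [] [] [])"
    by (rule runs_weaken[OF runs_Move]) (simp_all add: move_def)
  \<comment> \<open>\<open>us\<close> lists the translated tensors of \<open>A\<close>, last one
    first. Stack 4 is empty before the first translation and holds \<open>2 * 2 ^ t\<close> commas
    after each one.\<close>
  let ?\<sigma> = "\<lambda>us vs. st [] (concat (map (\<lambda>u. write_regexp (tensor_regexp t u) @ [Comma]) (rev us)) @ Semicolon # bs)
     (concat (map (\<lambda>u. Comma # rev (write_tensor t u)) vs)) []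
     (replicate (if us = [] then 0 else 2 * 2 ^ t) Comma) [] []"
  have "runs (Loop 2 (- {None}) tensor_step) (?\<sigma> [] (rev A)) (length (rev A) * (80 * D ^ 3 + 1) + 1)
      (?\<sigma> (rev A) [])"
  proof (rule runs_Loop_list)
    fix us vs :: "tensor list" and u
    have "top_of (concat (map (\<lambda>u. Comma # rev (write_tensor t u)) vs)) \<in> {None, Some Comma}"
      by (cases vs) simp_all
    then have "runs tensor_step (st [] x1 (Comma # rev (write_tensor t u) @
          concat (map (\<lambda>u. Comma # rev (write_tensor t u)) vs)) []
        (replicate (if us = [] then 0 else 2 * 2 ^ t) Comma) [] []) (80 * D ^ 3)
      (st [] (write_regexp (tensor_regexp t u) @ [Comma] @ x1)
        (concat (map (\<lambda>u. Comma # rev (write_tensor t u)) vs)) [] (replicate (2 * 2 ^ t) Comma) [] [])" for x1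
      unfolding D_def by (intro runs_tensor_step[OF t]) simp_all
    then show "runs tensor_step (?\<sigma> us (u # vs)) (80 * D ^ 3) (?\<sigma> (us @ [u]) vs)"
      by simp
  qed simp_all
  moreover have "concat (map (\<lambda>u. Comma # rev (write_tensor t u)) (rev A)) = rev as"
    by (simp add: as_def rev_concat rev_map o_def)
  moreover have "write_pair write_regexp write_string (map (tensor_regexp t) A) (map (tensor_string t) B)
     = concat (map (\<lambda>u. write_regexp (tensor_regexp t u) @ [Comma]) A) @ Semicolon # bs"
    by (simp add: write_pair_def bs_def o_def write_tensor_string)
  ultimately have 4: "runs (Loop 2 (- {None}) tensor_step) (st [] (Semicolon # bs) (rev as) [] [] [] [])
      (N * (80 * D ^ 3 + 1) + 1)
      (st [] (write_pair write_regexp write_string (map (tensor_regexp t) A) (map (tensor_string t) B))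
       [] [] (replicate (if A = [] then 0 else 2 * 2 ^ t) Comma) [] [])"
    by (simp add: len)
  \<comment> \<open>A constant number of steps remains even for \<open>N = 0\<close>; the maximum
    absorbs it.\<close>
  define M where "M = max 1 N"
  have "D \<ge> 1" by (simp add: D_def)
  then have "M * D \<le> M * D ^ 3" "M * 1 \<le> M * D ^ 3"
    by (intro mult_le_mono; simp add: self_le_power)+
  moreover have "N * D \<le> M * D" "N * D ^ 3 \<le> M * D ^ 3" "N \<le> M" "1 \<le> M"
    by (simp_all add: M_def)
  ultimately have "80 * (N * D ^ 3) + 6 * (N * D) + 7 * N + 7 \<le> 100 * (M * D ^ 3)"
    by linarith
  then have "4 * (N * (D + 1)) + 3 + (2 * (N * (D + 1)) + 1 + (1 + (N * (80 * D ^ 3 + 1) + 1 + 1)))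
      \<le> 100 * M * D ^ 3"
    by (simp add: algebra_simps)
  then show ?thesis
    unfolding reduction_def input D_def[symmetric] M_def[symmetric]
    by (intro runs_weaken[OF runs_seq_Cons[OF 1 runs_seq_Cons[OF 2 runs_seq_Cons[OF 3
          runs_seq_Cons[OF 4 runs_seq_Nil]]]]]) (simp_all add: D_def)
qed

section \<open>Correctness\<close>

lemma set_indices: "set (indices t) = {i. length i = t}"
proof (induction t)
  case (Suc t)
  show ?case
  proof (intro set_eqI iffI)
    fix i assume "i \<in> {i :: bool list. length i = Suc t}"
    then obtain b j where "i = b # j" "length j = t" by (auto simp: length_Suc_conv)
    then show "i \<in> set (indices (Suc t))" using Suc.IH by (cases b) auto
  qed (use Suc.IH in auto)
qed simp

text \<open>Tensors are extensional functions, so they share one default value outside the index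
  lists of length \<open>t\<close>.\<close>

lemma tensor_eqI:
  assumes "u \<in> tensors t" "v \<in> tensors t" "\<And>i. length i = t \<Longrightarrow> u i = v i"
  shows "u = v"
  using assms unfolding tensors_def by (auto intro: PiE_ext)

lemma inj_on_tensor_regexp:
  assumes "even t"
  shows "inj_on (tensor_regexp t) (tensors t)"
proof (rule inj_onI)
  fix u v
  assume *: "u \<in> tensors t" "v \<in> tensors t" "tensor_regexp t u = tensor_regexp t v"
  show "u = v"
  proof (rule tensor_eqI[OF *(1,2)])
    fix i :: "bool list"
    assume "length i = t"
    then have "leaf (u i) = leaf (v i)"
      using build_inject[of "t div 2" 2 "\<lambda>i. leaf (u i)" "\<lambda>i. leaf (v i)" i] * assms
      by (simp add: tensor_regexp_def)
    then show "u i = v i"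
      by (simp add: leaf_def any_symbol_def split: if_splits)
  qed
qed

lemma inj_on_tensor_string: "inj_on (tensor_string t) (tensors t)"
proof (rule inj_onI)
  fix u v
  assume *: "u \<in> tensors t" "v \<in> tensors t" "tensor_string t u = tensor_string t v"
  show "u = v"
  proof (rule tensor_eqI[OF *(1,2)])
    fix i :: "bool list"
    assume "length i = t"
    then have "bit_char (u i) = bit_char (v i)"
      using *(3) by (simp add: tensor_string_def set_indices)
    then show "u i = v i"
      by (simp add: bit_char_def split: if_splits)
  qed
qed

text \<open>This is \<open>build_mem_iff\<close> with blocks of one symbol. A leaf rejects its
  symbol exactly when both tensors have a 1 there, so the formula on the right becomes
  \<open>p_alt\<close>.\<close>

lemma tensor_string_mem_iff:
  assumes "even t"
  shows "tensor_string t v \<in> lang (tensor_regexp t u) \<longleftrightarrow> \<not> p_alt t u v"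
proof -
  have "map bit_char (concat (map (\<lambda>i. [v i]) (indices (2 * (t div 2))))) \<in>
      lang (build (t div 2) (2 * 1) (\<lambda>i. leaf (u i))) \<longleftrightarrow>
    \<not> alternate True (2 * (t div 2)) (\<lambda>i. map bit_char [v i] \<notin> lang (leaf (u i)))"
    by (rule build_mem_iff) (auto simp: leaf_def lang_any_symbol)
  moreover have "map bit_char [v i] \<notin> lang (leaf (u i)) \<longleftrightarrow> u i \<and> v i" for i
    by (auto simp: leaf_def any_symbol_def bit_char_def)
  moreover have "map bit_char (concat (map (\<lambda>i. [v i]) is)) = map (\<lambda>i. bit_char (v i)) is" for "is"
    by (induction "is") simp_all
  ultimately show ?thesis
    using assms by (simp add: tensor_string_def tensor_regexp_def p_alt_def o_def)
qed

theorem theorem7p3: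
  "\<exists>(P :: token program) (c::nat) (k::nat) (c'::nat) (k'::nat).
     \<forall>(t::nat) (N::nat) (A :: tensor list) (B :: tensor list).
       distinct A \<and> distinct B \<and> restricted_OAPT t N (set A) (set B) \<longrightarrow>
       (\<exists>(R :: regexp list) (S :: string list).
          computes_in_time P
            (write_pair (write_tensor t) (write_tensor t) A B)
            (write_pair write_regexp write_string R S)
            (c * max 1 N * (2 ^ t) ^ k) \<and>
          distinct R \<and> card (set R) = N \<and>
          distinct S \<and> card (set S) = N \<and>
          (\<forall>r \<in> set R. regexp_length r \<le> c' * (2 ^ t) ^ k') \<and>
          (\<forall>s \<in> set S. length s = 2 ^ t) \<and>
          (OAPT_answer t (set A) (set B) \<longleftrightarrow> RegExp_String_Pair_answer (set R) (set S)))"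
\<comment> \<open>The constants 100 and 3 come from \<open>runs_reduction\<close>, 5 and 2 from
  \<open>tensor_regexp_length\<close>.\<close>
proof (rule exI[of _ reduction], rule exI[of _ 100], rule exI[of _ 3], rule exI[of _ 5],
    rule exI[of _ 2], intro allI impI)
  fix t N :: nat and A B :: "tensor list"
  assume "distinct A \<and> distinct B \<and> restricted_OAPT t N (set A) (set B)"
  then have dist: "distinct A" "distinct B" and t: "even t"
    and sub: "set A \<subseteq> tensors t" "set B \<subseteq> tensors t" and card: "card (set A) = N" "card (set B) = N"
    by (auto simp: restricted_OAPT_def)
  have len: "length A = N" "length B = N"
    using dist card by (simp_all add: distinct_card)
  let ?R = "map (tensor_regexp t) A" and ?S = "map (tensor_string t) B"
  have "computes_in_time reduction (write_pair (write_tensor t) (write_tensor t) A B)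
      (write_pair write_regexp write_string ?R ?S) (100 * max 1 N * (2 ^ t) ^ 3)"
    using runs_reduction[OF t len] unfolding computes_in_time_def runs_def by fastforce
  \<comment> \<open>Injectivity on the tensors ensures that both output sets have exactly
    \<open>N\<close> elements.\<close>
  moreover have inj: "inj_on (tensor_regexp t) (set A)" "inj_on (tensor_string t) (set B)"
    using inj_on_tensor_regexp[OF t] inj_on_tensor_string sub by (blast intro: inj_on_subset)+
  then have "distinct ?R" "card (set ?R) = N" "distinct ?S" "card (set ?S) = N"
    using dist card by (simp_all add: distinct_map card_image)
  moreover have "\<forall>r \<in> set ?R. regexp_length r \<le> 5 * (2 ^ t) ^ 2"
    using tensor_regexp_length[OF t] by simp
  moreover have "\<forall>s \<in> set ?S. length s = 2 ^ t"
    by (simp add: tensor_string_def)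
  moreover have "OAPT_answer t (set A) (set B) \<longleftrightarrow> RegExp_String_Pair_answer (set ?R) (set ?S)"
    unfolding OAPT_answer_def RegExp_String_Pair_answer_def using tensor_string_mem_iff[OF t] by auto
  ultimately show "\<exists>R S. computes_in_time reduction (write_pair (write_tensor t) (write_tensor t) A B)
          (write_pair write_regexp write_string R S) (100 * max 1 N * (2 ^ t) ^ 3) \<and>
        distinct R \<and> card (set R) = N \<and> distinct S \<and> card (set S) = N \<and>
        (\<forall>r \<in> set R. regexp_length r \<le> 5 * (2 ^ t) ^ 2) \<and> (\<forall>s \<in> set S. length s = 2 ^ t) \<and>
        (OAPT_answer t (set A) (set B) \<longleftrightarrow> RegExp_String_Pair_answer (set R) (set S))"
    by blast
qed

end
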